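(* Let $T$ be a group, and set $Y=T/Z_1(T)$. Let $\lambda:T\to Y$ be the canonical projection, and consider the associated map $\Lambda:\mathrm{Aut}(T)\to\mathrm{Aut}(Y)$. Then for any $i\ge 0$, $\Lambda$ maps $\mathrm{Aut}_{i+2}(T)$ into $\mathrm{Aut}_{i+1}(Y)$, and the kernels of the induced maps $$\mathrm{Aut}_{i+2}(T)\to\mathrm{Aut}_{i+1}(Y)/\mathrm{Aut}_i(Y)\quad\text{and}\quad \mathrm{Inn}(T)\mathrm{Aut}_{i+2}(T)\to\mathrm{Inn}(Y)\mathrm{Aut}_{i+1}(Y)/\mathrm{Inn}(Y)\mathrm{Aut}_i(Y)$$ are $\mathrm{Aut}_{i+1}(T)$ and $\mathrm{Inn}(T)\mathrm{Aut}_{i+1}(T)$, respectively. Thus, $\mathrm{Aut}_{i+2}(T)/\mathrm{Aut}_{i+1}(T)$ is isomorphic to a subgroup of $\mathrm{Aut}_{i+1}(Y)/\mathrm{Aut}_i(Y)$, and $\mathrm{Inn}(T)\mathrm{Aut}_{i+2}(T)/\mathrm{Inn}(T)\mathrm{Aut}_{i+1}(T)$ imbeds into $\mathrm{Inn}(Y)\mathrm{Aut}_{i+1}(Y)/\mathrm{Inn}(Y)\mathrm{Aut}_i(Y)$.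
   Context: For a group $T$, $Z_0(T)=1, Z_1(T),Z_2(T),\dots$ denotes the upper central series, so that $Z_{i+1}(T)/Z_i(T)$ is the center of $T/Z_i(T)$, and $\mathrm{Aut}_i(T)$ is the kernel of the canonical map $\mathrm{Aut}(T)\to\mathrm{Aut}(T/Z_i(T))$; in particular $\mathrm{Aut}_0(T)$ is trivial. The map $\Lambda$ sends $g\in\mathrm{Aut}(T)$ to the automorphism of $Y$ it induces, namely $tZ_1(T)\mapsto t^gZ_1(T)$. *)

theory Defs
  imports "HOL-Algebra.Coset" "HOL-Algebra.Bij"
begin

definition center :: "('a, 'b) monoid_scheme \<Rightarrow> 'a set"
  where "center G = {z \<in> carrier G. \<forall>x \<in> carrier G. z \<otimes>\<^bsub>G\<^esub> x = x \<otimes>\<^bsub>G\<^esub> z}"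

text \<open>\<open>upper_central G i\<close> is \<open>Z\<^sub>i(G)\<close>; the successor step takes the full preimage in \<open>G\<close>
  of the center of \<open>G / Z\<^sub>i(G)\<close>.\<close>

primrec upper_central :: "('a, 'b) monoid_scheme \<Rightarrow> nat \<Rightarrow> 'a set" where
  "upper_central G 0 = {\<one>\<^bsub>G\<^esub>}"
| "upper_central G (Suc i) =
     {x \<in> carrier G. upper_central G i #>\<^bsub>G\<^esub> x \<in> center (G Mod upper_central G i)}"

text \<open>When \<open>g ` N = N\<close>, the image of the coset \<open>N #>\<^bsub>G\<^esub> t\<close> under \<open>g\<close> is \<open>N #>\<^bsub>G\<^esub> g t\<close>, so this
  is the map induced on \<open>G Mod N\<close>; see \<open>induced_auto_rcoset\<close> below. It is extensional
  because \<^const>\<open>auto\<close> consists of extensional functions.\<close>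

definition induced_auto :: "('a, 'b) monoid_scheme \<Rightarrow> 'a set \<Rightarrow> ('a \<Rightarrow> 'a) \<Rightarrow> ('a set \<Rightarrow> 'a set)"
  where "induced_auto G N g = (\<lambda>C \<in> carrier (G Mod N). g ` C)"

text \<open>\<^const>\<open>AutoGroup\<close> composes maps from right to left. With automorphisms acting on the right
  (\<open>t\<^sup>g\<^sup>h = (t\<^sup>g)\<^sup>h\<close>) one gets the opposite group, which has the same subgroups, normal subgroups
  and kernels.\<close>

definition Aut_central :: "('a, 'b) monoid_scheme \<Rightarrow> nat \<Rightarrow> ('a \<Rightarrow> 'a) set"
  where "Aut_central G i =
    kernel (AutoGroup G) (AutoGroup (G Mod upper_central G i)) (induced_auto G (upper_central G i))"

definition Inn :: "('a, 'b) monoid_scheme \<Rightarrow> ('a \<Rightarrow> 'a) set"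
  where "Inn G = (\<lambda>g. \<lambda>x \<in> carrier G. g \<otimes>\<^bsub>G\<^esub> x \<otimes>\<^bsub>G\<^esub> inv\<^bsub>G\<^esub> g) ` carrier G"

definition Inn_Aut_central :: "('a, 'b) monoid_scheme \<Rightarrow> nat \<Rightarrow> ('a \<Rightarrow> 'a) set"
  where "Inn_Aut_central G i = Inn G <#>\<^bsub>AutoGroup G\<^esub> Aut_central G i"


subsection \<open>The subgroups \<open>Z\<^sub>i(G)\<close> are characteristic and the induced maps are well defined\<close>

lemma (in normal) rcoset_in_center_iff:
  assumes "x \<in> carrier G"
  shows "H #> x \<in> center (G Mod H) \<longleftrightarrow> (\<forall>y \<in> carrier G. H #> (x \<otimes> y) = H #> (y \<otimes> x))"
  using assms by (auto simp: center_def carrier_FactGroup rcos_sum)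

lemma (in group) upper_central_normal: "upper_central G i \<lhd> G"
proof (induction i)
  case 0
  show ?case by (simp add: normal_inv_iff triv_subgroup)
next
  case (Suc i)
  define N where "N = upper_central G i"
  interpret N: normal N G using Suc by (simp add: N_def)
  define Z where "Z = upper_central G (Suc i)"
  have Z: "x \<in> Z \<longleftrightarrow> x \<in> carrier G \<and> (\<forall>y \<in> carrier G. N #> (x \<otimes> y) = N #> (y \<otimes> x))" for x
    using N.rcoset_in_center_iff by (auto simp: Z_def N_def)
  have eqI: "N #> (a \<otimes> b) = N #> (a' \<otimes> b')"
    if "N #> a = N #> a'" "N #> b = N #> b'"
      "a \<in> carrier G" "b \<in> carrier G" "a' \<in> carrier G" "b' \<in> carrier G" for a b a' b'
    using that by (simp flip: N.rcos_sum)
  have sub: "subgroup Z G"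
  proof (rule subgroupI)
    show "Z \<subseteq> carrier G" "Z \<noteq> {}" using Z one_closed by (auto, metis Z empty_iff l_one one_closed r_one)
  next
    fix a assume a: "a \<in> Z"
    then have ac: "a \<in> carrier G" using Z by blast
    have "N #> (inv a \<otimes> y) = N #> (y \<otimes> inv a)" if y: "y \<in> carrier G" for y
    proof -
      have "N #> (a \<otimes> (y \<otimes> inv a)) = N #> (y \<otimes> inv a \<otimes> a)"
        using a y ac Z by simp
      also have "y \<otimes> inv a \<otimes> a = y" using y ac by (simp add: m_assoc)
      finally have "N #> (inv a \<otimes> (a \<otimes> (y \<otimes> inv a))) = N #> (inv a \<otimes> y)"
        using y ac by - (rule eqI; auto)
      moreover have "inv a \<otimes> (a \<otimes> (y \<otimes> inv a)) = y \<otimes> inv a"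
        using y ac by (simp flip: m_assoc)
      ultimately show ?thesis by simp
    qed
    then show "inv a \<in> Z" using Z ac by simp
  next
    fix a b assume a: "a \<in> Z" and b: "b \<in> Z"
    then have c: "a \<in> carrier G" "b \<in> carrier G" using Z by auto
    have "N #> (a \<otimes> b \<otimes> y) = N #> (y \<otimes> (a \<otimes> b))" if y: "y \<in> carrier G" for y
    proof -
      have "N #> (a \<otimes> (b \<otimes> y)) = N #> (a \<otimes> (y \<otimes> b))"
        using b c y Z by - (rule eqI; auto)
      also have "a \<otimes> (y \<otimes> b) = a \<otimes> y \<otimes> b" using c y by (simp add: m_assoc)
      also have "N #> \<dots> = N #> (y \<otimes> a \<otimes> b)"
        using a c y Z by - (rule eqI; auto)
      finally show ?thesis using c y by (simp add: m_assoc)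
    qed
    then show "a \<otimes> b \<in> Z" using Z c by simp
  qed
  have "g \<otimes> h \<otimes> inv g \<in> Z" if g: "g \<in> carrier G" and h: "h \<in> Z" for g h
  proof -
    have hc: "h \<in> carrier G" using h Z by blast
    have "N #> (g \<otimes> h \<otimes> inv g) = N #> (h \<otimes> g \<otimes> inv g)"
      using h hc g Z by - (rule eqI; auto)
    also have "h \<otimes> g \<otimes> inv g = h" using hc g by (simp add: m_assoc)
    finally have eq: "N #> (g \<otimes> h \<otimes> inv g) = N #> h" .
    have "N #> (g \<otimes> h \<otimes> inv g \<otimes> y) = N #> (y \<otimes> (g \<otimes> h \<otimes> inv g))" if y: "y \<in> carrier G" for y
    proof -
      have "N #> (g \<otimes> h \<otimes> inv g \<otimes> y) = N #> (h \<otimes> y)" using eq hc g y by - (rule eqI; auto)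
      also have "\<dots> = N #> (y \<otimes> h)" using h y Z by simp
      also have "\<dots> = N #> (y \<otimes> (g \<otimes> h \<otimes> inv g))" using eq hc g y by - (rule eqI; auto)
      finally show ?thesis .
    qed
    then show ?thesis using Z g hc by simp
  qed
  with sub show ?case unfolding Z_def[symmetric] by (simp add: normal_inv_iff)
qed

lemma image_rcoset_auto:
  assumes "group G" "g \<in> auto G" "N \<subseteq> carrier G" "g ` N = N" "t \<in> carrier G"
  shows "g ` (N #>\<^bsub>G\<^esub> t) = N #>\<^bsub>G\<^esub> g t"
proof -
  have "g (n \<otimes>\<^bsub>G\<^esub> t) = g n \<otimes>\<^bsub>G\<^esub> g t" if "n \<in> N" for n
    using assms that by (auto simp: auto_def hom_def)
  then have "g ` (N #>\<^bsub>G\<^esub> t) = g ` N #>\<^bsub>G\<^esub> g t" by (auto simp: r_coset_def image_UN)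
  then show ?thesis using assms by simp
qed

lemma (in group) auto_image_upper_central:
  assumes g: "g \<in> auto G"
  shows "g ` upper_central G i = upper_central G i"
proof (induction i)
  case 0
  interpret gh: group_hom G G g
    using g by (simp add: group_hom_def group_hom_axioms_def auto_def)
  show ?case by simp
next
  case (Suc i)
  define N where "N = upper_central G i"
  interpret N: normal N G using upper_central_normal by (simp add: N_def)
  have bij: "bij_betw g (carrier G) (carrier G)" and hom: "g \<in> hom G G"
    using g by (auto simp: auto_def Bij_def)
  have gc: "g x \<in> carrier G" if "x \<in> carrier G" for x using hom that by (auto simp: hom_def)
  have surj: "\<exists>x \<in> carrier G. y = g x" if "y \<in> carrier G" for y
    using bij that by (auto simp: bij_betw_def)
  have cos: "N #> g t = g ` (N #> t)" if "t \<in> carrier G" for t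
    using image_rcoset_auto[OF is_group g N.subset _ that] Suc by (simp add: N_def)
  have inj: "N #> g s = N #> g t \<longleftrightarrow> N #> s = N #> t" if "s \<in> carrier G" "t \<in> carrier G" for s t
    using that cos bij N.subset
    by (metis bij_betw_def inj_on_image_eq_iff r_coset_subset_G)
  have Z: "x \<in> upper_central G (Suc i) \<longleftrightarrow>
      x \<in> carrier G \<and> (\<forall>y \<in> carrier G. N #> (x \<otimes> y) = N #> (y \<otimes> x))" for x
    using N.rcoset_in_center_iff by (auto simp: N_def)
  have *: "g x \<in> upper_central G (Suc i) \<longleftrightarrow> x \<in> upper_central G (Suc i)" if x: "x \<in> carrier G" for x
  proof -
    have "(\<forall>y \<in> carrier G. N #> (g x \<otimes> y) = N #> (y \<otimes> g x)) \<longleftrightarrow>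
        (\<forall>y \<in> carrier G. N #> (g x \<otimes> g y) = N #> (g y \<otimes> g x))"
      using surj gc by metis
    also have "\<dots> \<longleftrightarrow> (\<forall>y \<in> carrier G. N #> g (x \<otimes> y) = N #> g (y \<otimes> x))"
      using x hom by (simp add: hom_mult)
    also have "\<dots> \<longleftrightarrow> (\<forall>y \<in> carrier G. N #> (x \<otimes> y) = N #> (y \<otimes> x))"
      using x by (simp add: inj)
    finally show ?thesis using Z x gc by simp
  qed
  show ?case
  proof (intro equalityI subsetI)
    fix y assume "y \<in> g ` upper_central G (Suc i)"
    then show "y \<in> upper_central G (Suc i)" using * Z by blast
  next
    fix y assume y: "y \<in> upper_central G (Suc i)"
    then obtain x where "x \<in> carrier G" "y = g x" using surj Z by blast
    then show "y \<in> g ` upper_central G (Suc i)" using y * by blast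
  qed
qed

lemma (in group) induced_auto_rcoset:
  assumes "g \<in> auto G" "t \<in> carrier G"
  shows "induced_auto G (upper_central G i) g (upper_central G i #> t) = upper_central G i #> g t"
proof -
  have "upper_central G i \<subseteq> carrier G"
    using upper_central_normal by (simp add: normal_imp_subgroup subgroup.subset)
  then show ?thesis
    using assms image_rcoset_auto[OF is_group] auto_image_upper_central
    by (simp add: induced_auto_def carrier_FactGroup)
qed

lemma (in group) induced_auto_hom:
  "induced_auto G (upper_central G i) \<in> hom (AutoGroup G) (AutoGroup (G Mod upper_central G i))"
proof -
  define N where "N = upper_central G i"
  interpret N: normal N G using upper_central_normal by (simp add: N_def)
  have ind: "induced_auto G N g (N #> t) = N #> g t" if "g \<in> auto G" "t \<in> carrier G" for g t
    using induced_auto_rcoset that by (simp add: N_def)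
  have hg: "g \<in> hom G G" "bij_betw g (carrier G) (carrier G)" if "g \<in> auto G" for g
    using that by (auto simp: auto_def Bij_def)
  have gc: "g t \<in> carrier G" if "g \<in> auto G" "t \<in> carrier G" for g t
    using hg that by (auto simp: hom_def)
  have mem: "induced_auto G N g \<in> auto (G Mod N)" if g: "g \<in> auto G" for g
  proof -
    have "induced_auto G N g \<in> hom (G Mod N) (G Mod N)"
      using g by (auto simp: hom_def carrier_FactGroup ind gc N.rcos_sum hom_mult[OF hg(1)])
    moreover have "induced_auto G N g \<in> extensional (carrier (G Mod N))"
      by (simp add: induced_auto_def)
    moreover have "inj_on (induced_auto G N g) (carrier (G Mod N))"
    proof (rule inj_onI)
      fix C D assume CD: "C \<in> carrier (G Mod N)" "D \<in> carrier (G Mod N)"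
        "induced_auto G N g C = induced_auto G N g D"
      then have "C \<subseteq> carrier G" "D \<subseteq> carrier G" "g ` C = g ` D"
        using N.subset by (auto simp: induced_auto_def carrier_FactGroup r_coset_def)
      then show "C = D" using hg[OF g] by (metis bij_betw_def inj_on_image_eq_iff)
    qed
    moreover have "induced_auto G N g ` carrier (G Mod N) = carrier (G Mod N)"
    proof -
      have "induced_auto G N g ` carrier (G Mod N) = (\<lambda>t. N #> t) ` g ` carrier G"
        unfolding carrier_FactGroup image_image using ind[OF g] by (intro image_cong) auto
      also have "g ` carrier G = carrier G" using hg[OF g] by (simp add: bij_betw_def)
      finally show ?thesis by (simp add: carrier_FactGroup)
    qed
    ultimately show ?thesis by (simp add: auto_def Bij_def bij_betw_def)
  qed
  have "induced_auto G N (compose (carrier G) g h) =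
      compose (carrier (G Mod N)) (induced_auto G N g) (induced_auto G N h)"
    if "g \<in> auto G" "h \<in> auto G" "compose (carrier G) g h \<in> auto G" for g h
  proof (rule extensionalityI[of _ "carrier (G Mod N)"])
    fix C assume "C \<in> carrier (G Mod N)"
    then obtain t where t: "t \<in> carrier G" "C = N #> t" by (auto simp: carrier_FactGroup)
    then show "induced_auto G N (compose (carrier G) g h) C =
        compose (carrier (G Mod N)) (induced_auto G N g) (induced_auto G N h) C"
      using that gc by (simp add: ind compose_eq carrier_FactGroup)
  qed (auto simp: induced_auto_def)
  moreover have "compose (carrier G) g h \<in> auto G" if "g \<in> auto G" "h \<in> auto G" for g h
    using that by (auto simp: auto_def compose_Bij hom_compose Bij_imp_funcset)
  moreover have "auto H \<subseteq> Bij (carrier H)" for H :: "('c, 'd) monoid_scheme"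
    by (simp add: auto_def)
  ultimately show ?thesis unfolding N_def[symmetric]
    using mem by (auto simp: hom_def AutoGroup_def BijGroup_def subset_iff auto_def)
qed

end

theory Submission
  imports Defs "HOL-Algebra.SndIsomorphismGrp"
begin

text \<open>
  Write \<open>Y = T / Z\<^sub>1(T)\<close>. The upper central series of \<open>Y\<close> is that of \<open>T\<close> with the index shifted by
  one: \<open>Z\<^sub>i(Y) = Z\<^bsub>i+1\<^esub>(T) / Z\<^sub>1(T)\<close> (\<open>rcoset_in_upper_central_center_quotient\<close>). Therefore
  \<open>Y / Z\<^sub>i(Y)\<close> and \<open>T / Z\<^bsub>i+1\<^esub>(T)\<close> are the same quotient of \<open>T\<close>, and an automorphism \<open>g\<close> of \<open>T\<close> acts
  trivially on the one exactly when it acts trivially on the other. In other words,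
  \<open>Aut\<^bsub>i+1\<^esub>(T)\<close> is the full preimage of \<open>Aut\<^sub>i(Y)\<close> under \<open>\<Lambda>\<close>
  (\<open>induced_auto_in_Aut_central_iff\<close>).

  Since \<open>\<Lambda>\<close> maps the inner automorphism of \<open>t\<close> to that of \<open>t Z\<^sub>1(T)\<close>, it maps \<open>Inn(T)\<close> onto
  \<open>Inn(Y)\<close>, and this surjectivity upgrades the preimage statement to: \<open>Inn(T) Aut\<^bsub>i+1\<^esub>(T)\<close> is the full
  preimage of \<open>Inn(Y) Aut\<^sub>i(Y)\<close> (\<open>induced_auto_in_Inn_Aut_central_iff\<close>).

  Each part of the theorem is now an instance of one fact about a homomorphism \<open>h : A \<rightarrow> B\<close>, a subgroup
  \<open>L\<close> of \<open>B\<close> and a normal subgroup \<open>K\<close> of \<open>B\<close> with \<open>K \<subseteq> L\<close>: the homomorphism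
  \<open>h\<^sup>-\<^sup>1(L) \<rightarrow> L / K\<close> has kernel \<open>h\<^sup>-\<^sup>1(K)\<close>, and so embeds \<open>h\<^sup>-\<^sup>1(L) / h\<^sup>-\<^sup>1(K)\<close> into \<open>L / K\<close>.
\<close>


section \<open>Homomorphisms into a subquotient\<close>

lemma (in subgroup) rcos_eq_iff:
  assumes "group G" "x \<in> carrier G" "y \<in> carrier G"
  shows "H #> x = H #> y \<longleftrightarrow> x \<otimes> inv y \<in> H"
proof -
  have "H #> x = H #> y \<longleftrightarrow> x \<in> H #> y"
    using assms subgroup_axioms by (metis group.rcos_self group.repr_independence)
  then show ?thesis using rcos_module assms by blast
qed

text \<open>The homomorphism is the composition of \<open>h\<close>, restricted to \<open>M\<close> and corestricted to \<open>L\<close>, with the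
  projection \<open>L \<rightarrow> L / K\<close>; its kernel is computed from \<open>K #> y = K \<longleftrightarrow> y \<in> K\<close>.\<close>

lemma (in group_hom) hom_into_subquotient:
  assumes M: "subgroup M G" and L: "subgroup L H" and K: "K \<lhd> H" "K \<subseteq> L" and hM: "h \<in> M \<rightarrow> L"
  shows "K \<lhd> H\<lparr>carrier := L\<rparr>"
    and "group_hom (G\<lparr>carrier := M\<rparr>) (H\<lparr>carrier := L\<rparr> Mod K) (\<lambda>g. K #>\<^bsub>H\<^esub> h g)"
    and "kernel (G\<lparr>carrier := M\<rparr>) (H\<lparr>carrier := L\<rparr> Mod K) (\<lambda>g. K #>\<^bsub>H\<^esub> h g) = {g \<in> M. h g \<in> K}"
proof -
  show KL: "K \<lhd> H\<lparr>carrier := L\<rparr>"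
    using H.normal_restrict_supergroup L K by blast
  interpret K: normal K H by fact
  interpret KL: normal K "H\<lparr>carrier := L\<rparr>" by fact
  interpret L: group "H\<lparr>carrier := L\<rparr>" using H.subgroup_imp_group L by blast
  interpret M: group "G\<lparr>carrier := M\<rparr>" using G.subgroup_imp_group M by blast
  have MG: "g \<in> carrier G" if "g \<in> M" for g using that M by (simp add: subgroup.mem_carrier)
  have proj: "(#>\<^bsub>H\<^esub>) K \<in> hom (H\<lparr>carrier := L\<rparr>) (H\<lparr>carrier := L\<rparr> Mod K)"
    using KL.r_coset_hom_Mod by (simp add: r_coset_def [abs_def])
  have "h \<in> hom (G\<lparr>carrier := M\<rparr>) (H\<lparr>carrier := L\<rparr>)"
    using hM MG by (auto simp: hom_def)
  from Group.hom_compose[OF this proj]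
  show "group_hom (G\<lparr>carrier := M\<rparr>) (H\<lparr>carrier := L\<rparr> Mod K) (\<lambda>g. K #>\<^bsub>H\<^esub> h g)"
    by (simp add: group_hom_def group_hom_axioms_def M.is_group KL.factorgroup_is_group o_def)
  have "K #>\<^bsub>H\<^esub> h g = K \<longleftrightarrow> h g \<in> K" if "g \<in> M" for g
    using MG[OF that] hom_closed K.subgroup_axioms by (metis H.coset_join2 H.rcos_self)
  then show "kernel (G\<lparr>carrier := M\<rparr>) (H\<lparr>carrier := L\<rparr> Mod K) (\<lambda>g. K #>\<^bsub>H\<^esub> h g) = {g \<in> M. h g \<in> K}"
    by (simp add: kernel_def cong: conj_cong)
qed

text \<open>The first isomorphism theorem for maps that need not be onto, obtained by taking the image as
  codomain.\<close>

lemma (in group_hom) FactGroup_kernel_iso_subgroup: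
  "\<exists>S. subgroup S H \<and> G Mod kernel G H h \<cong> H\<lparr>carrier := S\<rparr>"
proof -
  interpret img: group "H\<lparr>carrier := h ` carrier G\<rparr>"
    by (rule H.subgroup_imp_group[OF img_is_subgroup])
  interpret onto: group_hom G "H\<lparr>carrier := h ` carrier G\<rparr>" h
    by unfold_locales (auto simp: hom_def)
  have "kernel G (H\<lparr>carrier := h ` carrier G\<rparr>) h = kernel G H h" by (simp add: kernel_def)
  then show ?thesis using onto.FactGroup_iso img_is_subgroup by auto
qed

lemma (in group_hom) FactGroup_kernel_mon:
  "\<exists>f. f \<in> mon (G Mod kernel G H h) H"
  using FactGroup_hom FactGroup_inj_on by (auto simp: mon_def)


section \<open>The upper central series of the quotient by the center\<close>

text \<open>Commuting modulo \<open>Z\<^sub>i\<close> is expressed by the commutator \<open>[x, y] = x y (y x)\<^sup>-\<^sup>1\<close>. A surjective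
  homomorphism maps the commutators of \<open>x\<close> onto those of the image of \<open>x\<close>, so in this form the
  recursion in \<open>G / Z\<^sub>1(G)\<close> can be followed in \<open>G\<close> itself.\<close>

lemma (in group) in_upper_central_Suc_iff:
  "x \<in> upper_central G (Suc i) \<longleftrightarrow>
     x \<in> carrier G \<and> (\<forall>y \<in> carrier G. x \<otimes> y \<otimes> inv (y \<otimes> x) \<in> upper_central G i)"
proof -
  interpret N: normal "upper_central G i" G by (rule upper_central_normal)
  show ?thesis
    by (auto simp: N.rcoset_in_center_iff N.rcos_eq_iff[OF is_group])
qed

text \<open>In \<open>[x, y] = x (y x\<^sup>-\<^sup>1 y\<^sup>-\<^sup>1)\<close> both factors lie in the normal subgroup \<open>Z\<^sub>i\<close> if \<open>x\<close> does.\<close>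

lemma (in group) upper_central_le_Suc: "upper_central G i \<subseteq> upper_central G (Suc i)"
proof
  fix x assume x: "x \<in> upper_central G i"
  interpret N: normal "upper_central G i" G by (rule upper_central_normal)
  have xc: "x \<in> carrier G" using x by (rule N.mem_carrier)
  have "x \<otimes> y \<otimes> inv (y \<otimes> x) \<in> upper_central G i" if y: "y \<in> carrier G" for y
  proof -
    have "x \<otimes> y \<otimes> inv (y \<otimes> x) = x \<otimes> (y \<otimes> inv x \<otimes> inv y)"
      using xc y by (simp add: inv_mult_group m_assoc)
    then show ?thesis using x y by (simp add: N.inv_op_closed2)
  qed
  then show "x \<in> upper_central G (Suc i)" using xc by (simp only: in_upper_central_Suc_iff) simp
qed

text \<open>Both series start together, as \<open>x Z\<^sub>1\<close> is trivial exactly when \<open>x \<in> Z\<^sub>1\<close>. They then follow the same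
  commutator recursion, since the commutators of \<open>x Z\<^sub>1\<close> are the cosets of the commutators of \<open>x\<close>.\<close>

lemma (in group) rcoset_in_upper_central_center_quotient:
  assumes "x \<in> carrier G"
  shows "upper_central G 1 #> x \<in> upper_central (G Mod upper_central G 1) i \<longleftrightarrow>
    x \<in> upper_central G (Suc i)"
  using assms
proof (induction i arbitrary: x)
  case 0
  interpret Z: normal "upper_central G 1" G by (rule upper_central_normal)
  have "upper_central G 1 #> x = upper_central G 1 \<longleftrightarrow> x \<in> upper_central G 1"
    using 0 Z.subgroup_axioms by (metis coset_join2 rcos_self)
  then show ?case by (simp del: upper_central.simps(2) add: upper_central.simps(1))
next
  case (Suc i)
  define Z where "Z = upper_central G 1"
  interpret Z: normal Z G unfolding Z_def by (rule upper_central_normal)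
  interpret Y: group "G Mod Z" by (rule Z.factorgroup_is_group)
  interpret p: group_hom G "G Mod Z" "(#>) Z"
    using Z.r_coset_hom_Mod by unfold_locales
  have comm: "(Z #> x) \<otimes>\<^bsub>G Mod Z\<^esub> (Z #> y) \<otimes>\<^bsub>G Mod Z\<^esub> inv\<^bsub>G Mod Z\<^esub> ((Z #> y) \<otimes>\<^bsub>G Mod Z\<^esub> (Z #> x))
      = Z #> (x \<otimes> y \<otimes> inv (y \<otimes> x))" if "y \<in> carrier G" for y
    using that Suc.prems by (simp only: p.hom_mult[symmetric] p.hom_inv[symmetric] m_closed inv_closed)
  have "Z #> x \<in> upper_central (G Mod Z) (Suc i) \<longleftrightarrow>
      (\<forall>y \<in> carrier G. Z #> (x \<otimes> y \<otimes> inv (y \<otimes> x)) \<in> upper_central (G Mod Z) i)"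
    using Suc.prems p.hom_closed comm
    by (simp only: Y.in_upper_central_Suc_iff carrier_FactGroup ball_simps) auto
  also have "\<dots> \<longleftrightarrow> (\<forall>y \<in> carrier G. x \<otimes> y \<otimes> inv (y \<otimes> x) \<in> upper_central G (Suc i))"
    using Suc by (simp add: Z_def del: upper_central.simps)
  also have "\<dots> \<longleftrightarrow> x \<in> upper_central G (Suc (Suc i))"
    using Suc.prems by (simp only: in_upper_central_Suc_iff[of _ "Suc i"]) simp
  finally show ?case by (simp add: Z_def del: upper_central.simps)
qed


section \<open>The groups of central automorphisms\<close>

lemma carrier_AutoGroup [simp]: "carrier (AutoGroup G) = auto G"
  by (simp add: AutoGroup_def)

lemma one_AutoGroup: "\<one>\<^bsub>AutoGroup G\<^esub> = (\<lambda>x \<in> carrier G. x)"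
  by (simp add: AutoGroup_def BijGroup_def)

lemma mult_AutoGroup:
  "f \<in> auto G \<Longrightarrow> g \<in> auto G \<Longrightarrow> f \<otimes>\<^bsub>AutoGroup G\<^esub> g = compose (carrier G) f g"
  by (simp add: AutoGroup_def BijGroup_def auto_def)

lemma auto_closed: "g \<in> auto G \<Longrightarrow> t \<in> carrier G \<Longrightarrow> g t \<in> carrier G"
  by (auto simp: auto_def hom_def)

lemma auto_hom: "g \<in> auto G \<Longrightarrow> g \<in> hom G G"
  by (simp add: auto_def)

lemma auto_eqI:
  assumes "f \<in> auto G" "g \<in> auto G" "\<And>t. t \<in> carrier G \<Longrightarrow> f t = g t"
  shows "f = g"
  using assms by (intro extensionalityI[of f "carrier G" g]) (auto simp: auto_def Bij_def)

lemma (in group) induced_auto_group_hom: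
  "group_hom (AutoGroup G) (AutoGroup (G Mod upper_central G i)) (induced_auto G (upper_central G i))"
  using induced_auto_hom AutoGroup group.AutoGroup[OF normal.factorgroup_is_group[OF upper_central_normal]]
  by (simp add: group_hom_def group_hom_axioms_def)

lemma (in group) Aut_central_normal: "Aut_central G i \<lhd> AutoGroup G"
  unfolding Aut_central_def by (rule group_hom.normal_kernel[OF induced_auto_group_hom])

lemma (in group) in_Aut_central_iff:
  "g \<in> Aut_central G i \<longleftrightarrow>
     g \<in> auto G \<and> (\<forall>t \<in> carrier G. g t \<otimes> inv t \<in> upper_central G i)"
proof (cases "g \<in> auto G")
  case g: True
  define N where "N = upper_central G i"
  interpret N: normal N G unfolding N_def by (rule upper_central_normal)
  have "g \<in> Aut_central G i \<longleftrightarrow> induced_auto G N g = (\<lambda>C \<in> carrier (G Mod N). C)"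
    using g by (simp add: Aut_central_def kernel_def one_AutoGroup N_def)
  also have "\<dots> \<longleftrightarrow> (\<forall>C \<in> carrier (G Mod N). induced_auto G N g C = C)"
    by (auto simp: induced_auto_def restrict_def fun_eq_iff)
  also have "\<dots> \<longleftrightarrow> (\<forall>t \<in> carrier G. N #> g t = N #> t)"
    using g induced_auto_rcoset by (auto simp: carrier_FactGroup N_def)
  also have "\<dots> \<longleftrightarrow> (\<forall>t \<in> carrier G. g t \<otimes> inv t \<in> N)"
    using auto_closed[OF g] by (intro ball_cong refl N.rcos_eq_iff[OF is_group])
  finally show ?thesis using g by (simp add: N_def)
qed (simp add: Aut_central_def kernel_def)

lemma (in group) Aut_central_le_Suc: "Aut_central G i \<subseteq> Aut_central G (Suc i)"
  using upper_central_le_Suc[of i] unfolding in_Aut_central_iff subset_iff by blast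

text \<open>For \<open>t \<in> G\<close>, the element \<open>\<Lambda>(g)(t Z\<^sub>1) (t Z\<^sub>1)\<^sup>-\<^sup>1\<close> of \<open>Y = G / Z\<^sub>1(G)\<close> is the coset of \<open>g(t) t\<^sup>-\<^sup>1\<close>, so
  that it lies in \<open>Z\<^sub>i(Y)\<close> exactly when \<open>g(t) t\<^sup>-\<^sup>1\<close> lies in \<open>Z\<^bsub>i+1\<^esub>(G)\<close>.\<close>

lemma (in group) induced_auto_in_Aut_central_iff:
  assumes g: "g \<in> auto G"
  shows "induced_auto G (upper_central G 1) g \<in> Aut_central (G Mod upper_central G 1) i \<longleftrightarrow>
    g \<in> Aut_central G (Suc i)"
proof -
  define Z where "Z = upper_central G 1"
  define \<Lambda> where "\<Lambda> = induced_auto G Z"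
  interpret Z: normal Z G unfolding Z_def by (rule upper_central_normal)
  interpret Y: group "G Mod Z" by (rule Z.factorgroup_is_group)
  interpret p: group_hom G "G Mod Z" "(#>) Z"
    using Z.r_coset_hom_Mod by unfold_locales
  interpret L: group_hom "AutoGroup G" "AutoGroup (G Mod Z)" \<Lambda>
    unfolding Z_def \<Lambda>_def by (rule induced_auto_group_hom)
  have \<Lambda>g: "\<Lambda> g \<in> auto (G Mod Z)" using L.hom_closed g by simp
  have quot: "\<Lambda> g (Z #> t) \<otimes>\<^bsub>G Mod Z\<^esub> inv\<^bsub>G Mod Z\<^esub> (Z #> t) = Z #> (g t \<otimes> inv t)"
    if t: "t \<in> carrier G" for t
  proof -
    have "\<Lambda> g (Z #> t) = Z #> g t"
      using g t induced_auto_rcoset by (simp only: Z_def \<Lambda>_def)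
    then show ?thesis
      using auto_closed[OF g t] t by (simp only: p.hom_mult[symmetric] p.hom_inv[symmetric] inv_closed)
  qed
  have "\<Lambda> g \<in> Aut_central (G Mod Z) i \<longleftrightarrow>
      (\<forall>t \<in> carrier G. Z #> (g t \<otimes> inv t) \<in> upper_central (G Mod Z) i)"
    using \<Lambda>g quot by (simp only: Y.in_Aut_central_iff carrier_FactGroup ball_simps) auto
  also have "\<dots> \<longleftrightarrow> (\<forall>t \<in> carrier G. g t \<otimes> inv t \<in> upper_central G (Suc i))"
    unfolding Z_def using auto_closed[OF g]
    by (intro ball_cong refl rcoset_in_upper_central_center_quotient) simp
  also have "\<dots> \<longleftrightarrow> g \<in> Aut_central G (Suc i)"
    using g by (simp only: in_Aut_central_iff) simp
  finally show ?thesis by (simp only: Z_def \<Lambda>_def)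
qed


section \<open>Inner automorphisms\<close>

definition inner_auto :: "('a, 'b) monoid_scheme \<Rightarrow> 'a \<Rightarrow> 'a \<Rightarrow> 'a"
  where "inner_auto G a = (\<lambda>x \<in> carrier G. a \<otimes>\<^bsub>G\<^esub> x \<otimes>\<^bsub>G\<^esub> inv\<^bsub>G\<^esub> a)"

lemma Inn_eq: "Inn G = inner_auto G ` carrier G"
  by (simp add: Inn_def inner_auto_def)

lemma (in group) inner_auto_in_auto:
  assumes a: "a \<in> carrier G"
  shows "inner_auto G a \<in> auto G"
proof -
  have cancel: "inv a \<otimes> (a \<otimes> x) = x" "a \<otimes> (inv a \<otimes> x) = x" if "x \<in> carrier G" for x
    using a that by (simp_all flip: m_assoc)
  have "inner_auto G a \<in> hom G G"
  proof (rule homI)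
    fix x y assume xy: "x \<in> carrier G" "y \<in> carrier G"
    then show "inner_auto G a (x \<otimes> y) = inner_auto G a x \<otimes> inner_auto G a y"
      using a cancel by (simp add: inner_auto_def m_assoc)
  qed (use a in \<open>simp add: inner_auto_def\<close>)
  moreover have "bij_betw (inner_auto G a) (carrier G) (carrier G)"
  proof (rule bij_betw_byWitness[of _ "inner_auto G (inv a)"])
    show "\<forall>x \<in> carrier G. inner_auto G (inv a) (inner_auto G a x) = x"
      and "\<forall>x \<in> carrier G. inner_auto G a (inner_auto G (inv a) x) = x"
      using a cancel by (simp_all add: inner_auto_def m_assoc)
  qed (use a in \<open>auto simp: inner_auto_def\<close>)
  ultimately show ?thesis by (simp add: auto_def Bij_def inner_auto_def)
qed

lemma (in group) inner_auto_hom: "inner_auto G \<in> hom G (AutoGroup G)"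
proof (rule homI)
  fix a b assume a: "a \<in> carrier G" and b: "b \<in> carrier G"
  then have in_auto: "inner_auto G a \<in> auto G" "inner_auto G b \<in> auto G" "inner_auto G (a \<otimes> b) \<in> auto G"
    by (simp_all add: inner_auto_in_auto)
  interpret A: group "AutoGroup G" by (rule AutoGroup)
  have prod: "inner_auto G a \<otimes>\<^bsub>AutoGroup G\<^esub> inner_auto G b \<in> auto G"
    using A.m_closed in_auto by simp
  show "inner_auto G (a \<otimes> b) = inner_auto G a \<otimes>\<^bsub>AutoGroup G\<^esub> inner_auto G b"
  proof (rule auto_eqI[OF in_auto(3) prod])
    fix t assume "t \<in> carrier G"
    then show "inner_auto G (a \<otimes> b) t = (inner_auto G a \<otimes>\<^bsub>AutoGroup G\<^esub> inner_auto G b) t"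
      using a b by (simp add: mult_AutoGroup in_auto compose_eq) (simp add: inner_auto_def inv_mult_group m_assoc)
  qed
qed (simp add: inner_auto_in_auto)

text \<open>Normality is the identity \<open>g c\<^sub>a g\<^sup>-\<^sup>1 = c\<^bsub>g(a)\<^esub>\<close>, where \<open>c\<^sub>a\<close> is conjugation by \<open>a\<close>.\<close>

lemma (in group) Inn_normal: "Inn G \<lhd> AutoGroup G"
proof -
  interpret A: group "AutoGroup G" by (rule AutoGroup)
  interpret c: group_hom G "AutoGroup G" "inner_auto G"
    using inner_auto_hom by unfold_locales
  have "g \<otimes>\<^bsub>AutoGroup G\<^esub> inner_auto G a \<otimes>\<^bsub>AutoGroup G\<^esub> inv\<^bsub>AutoGroup G\<^esub> g = inner_auto G (g a)"
    if g: "g \<in> auto G" and a: "a \<in> carrier G" for g a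
  proof -
    interpret g: group_hom G G g using auto_hom[OF g] by unfold_locales
    have in_auto: "inner_auto G a \<in> auto G" "inner_auto G (g a) \<in> auto G"
      using a by (simp_all add: inner_auto_in_auto)
    have "g \<otimes>\<^bsub>AutoGroup G\<^esub> inner_auto G a = inner_auto G (g a) \<otimes>\<^bsub>AutoGroup G\<^esub> g"
    proof (rule auto_eqI)
      show "g \<otimes>\<^bsub>AutoGroup G\<^esub> inner_auto G a \<in> auto G" "inner_auto G (g a) \<otimes>\<^bsub>AutoGroup G\<^esub> g \<in> auto G"
        using A.m_closed g in_auto by simp_all
    qed (use a g in_auto in \<open>simp add: mult_AutoGroup compose_eq, simp add: inner_auto_def\<close>)
    then show ?thesis using g in_auto
      by (simp add: A.m_assoc carrier_AutoGroup[symmetric] del: carrier_AutoGroup)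
  qed
  moreover have "subgroup (Inn G) (AutoGroup G)"
    unfolding Inn_eq by (rule c.img_is_subgroup)
  ultimately show ?thesis using auto_closed by (fastforce simp: A.normal_inv_iff Inn_eq)
qed

lemma (in group) Inn_Aut_central_normal: "Inn_Aut_central G i \<lhd> AutoGroup G"
  unfolding Inn_Aut_central_def
  by (intro group.normal_subgroup_set_mult_closed AutoGroup Inn_normal Aut_central_normal)

lemma (in group) Inn_Aut_central_le_Suc: "Inn_Aut_central G i \<subseteq> Inn_Aut_central G (Suc i)"
  unfolding Inn_Aut_central_def by (intro mono_set_mult Aut_central_le_Suc subset_refl)

lemma (in group) induced_auto_inner_auto:
  assumes a: "a \<in> carrier G"
  shows "induced_auto G (upper_central G i) (inner_auto G a) =
    inner_auto (G Mod upper_central G i) (upper_central G i #> a)"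
proof -
  define N where "N = upper_central G i"
  interpret N: normal N G unfolding N_def by (rule upper_central_normal)
  interpret Q: group "G Mod N" by (rule N.factorgroup_is_group)
  interpret p: group_hom G "G Mod N" "(#>) N"
    using N.r_coset_hom_Mod by unfold_locales
  interpret L: group_hom "AutoGroup G" "AutoGroup (G Mod N)" "induced_auto G N"
    unfolding N_def by (rule induced_auto_group_hom)
  have "induced_auto G N (inner_auto G a) = inner_auto (G Mod N) (N #> a)"
  proof (rule auto_eqI)
    show "induced_auto G N (inner_auto G a) \<in> auto (G Mod N)"
      using L.hom_closed inner_auto_in_auto[OF a] by simp
    show "inner_auto (G Mod N) (N #> a) \<in> auto (G Mod N)"
      using Q.inner_auto_in_auto p.hom_closed a by blast
    fix C assume "C \<in> carrier (G Mod N)"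
    then obtain t where t: "t \<in> carrier G" "C = N #> t" by (auto simp: carrier_FactGroup)
    have "induced_auto G N (inner_auto G a) C = N #> (a \<otimes> t \<otimes> inv a)"
      using induced_auto_rcoset[OF inner_auto_in_auto[OF a] t(1)] t
      by (simp add: N_def) (simp add: inner_auto_def)
    also have "\<dots> = inner_auto (G Mod N) (N #> a) C"
      using a t p.hom_closed by (simp only: p.hom_mult p.hom_inv inner_auto_def restrict_apply' m_closed inv_closed)
    finally show "induced_auto G N (inner_auto G a) C = inner_auto (G Mod N) (N #> a) C" .
  qed
  then show ?thesis by (simp only: N_def)
qed

lemma (in group) induced_auto_image_Inn:
  "induced_auto G (upper_central G i) ` Inn G = Inn (G Mod upper_central G i)"
  unfolding Inn_eq carrier_FactGroup image_image
  by (intro image_cong refl induced_auto_inner_auto)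

text \<open>Preimages do not commute with products of subsets in general: a factorization \<open>h g = j b\<close> need not
  lift to \<open>g\<close>. It does here because \<open>h\<close> maps \<open>I\<close> onto \<open>J\<close> and \<open>I\<close> is a subgroup.\<close>

lemma (in group_hom) vimage_set_mult:
  assumes I: "subgroup I G" and hI: "h ` I = J"
    and A: "A \<subseteq> carrier G" and AB: "\<And>x. x \<in> carrier G \<Longrightarrow> h x \<in> B \<longleftrightarrow> x \<in> A"
    and B: "B \<subseteq> carrier H" and g: "g \<in> carrier G"
  shows "h g \<in> J <#>\<^bsub>H\<^esub> B \<longleftrightarrow> g \<in> I <#> A"
proof
  have IG: "c \<in> carrier G" if "c \<in> I" for c using I that by (rule subgroup.mem_carrier)
  assume "h g \<in> J <#>\<^bsub>H\<^esub> B"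
  then obtain c b where c: "c \<in> I" and b: "b \<in> B" "h g = h c \<otimes>\<^bsub>H\<^esub> b"
    using hI by (auto simp: set_mult_def)
  \<comment> \<open>Lifting the \<open>J\<close>-factor to \<open>c \<in> I\<close> leaves the cofactor \<open>c\<^sup>-\<^sup>1 g\<close>, which maps into \<open>B\<close>.\<close>
  have "h (inv c \<otimes> g) = b"
    using b B g IG[OF c] by (auto simp flip: H.m_assoc)
  then have "inv c \<otimes> g \<in> A"
    using AB[of "inv c \<otimes> g"] b(1) g IG[OF c] by simp
  moreover have "g = c \<otimes> (inv c \<otimes> g)" using g IG[OF c] by (simp flip: G.m_assoc)
  ultimately show "g \<in> I <#> A" using c unfolding set_mult_def by blast
next
  have IG: "c \<in> carrier G" if "c \<in> I" for c using I that by (rule subgroup.mem_carrier)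
  assume "g \<in> I <#> A"
  then obtain c a where "c \<in> I" "a \<in> A" "g = c \<otimes> a" by (auto simp: set_mult_def)
  moreover from this have "h g = h c \<otimes>\<^bsub>H\<^esub> h a" "h a \<in> B" using A AB IG by auto
  ultimately show "h g \<in> J <#>\<^bsub>H\<^esub> B" using hI unfolding set_mult_def by blast
qed

lemma (in group) induced_auto_in_Inn_Aut_central_iff:
  assumes g: "g \<in> auto G"
  shows "induced_auto G (upper_central G 1) g \<in> Inn_Aut_central (G Mod upper_central G 1) i \<longleftrightarrow>
    g \<in> Inn_Aut_central G (Suc i)"
  unfolding Inn_Aut_central_def
proof (rule group_hom.vimage_set_mult[OF induced_auto_group_hom])
  interpret Y: group "G Mod upper_central G 1"
    by (rule normal.factorgroup_is_group[OF upper_central_normal])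
  show "subgroup (Inn G) (AutoGroup G)" by (rule normal_imp_subgroup[OF Inn_normal])
  show "induced_auto G (upper_central G 1) ` Inn G = Inn (G Mod upper_central G 1)"
    by (rule induced_auto_image_Inn)
  show "Aut_central G (Suc i) \<subseteq> carrier (AutoGroup G)"
    by (rule subgroup.subset[OF normal_imp_subgroup[OF Aut_central_normal]])
  show "Aut_central (G Mod upper_central G 1) i \<subseteq> carrier (AutoGroup (G Mod upper_central G 1))"
    by (rule subgroup.subset[OF normal_imp_subgroup[OF Y.Aut_central_normal]])
qed (use g induced_auto_in_Aut_central_iff in simp_all)


section \<open>The embeddings of the quotients\<close>

theorem proposition6p9:
  fixes T :: "('a, 'b) monoid_scheme" and Y :: "'a set monoid"
    and \<Lambda> :: "('a \<Rightarrow> 'a) \<Rightarrow> ('a set \<Rightarrow> 'a set)" and i :: nat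
  assumes T: "group T"
    and Y: "Y = T Mod upper_central T 1"
    and \<Lambda>: "\<Lambda> = induced_auto T (upper_central T 1)"
  shows "\<Lambda> \<in> Aut_central T (i + 2) \<rightarrow> Aut_central Y (i + 1) \<and>
     \<Lambda> \<in> Inn_Aut_central T (i + 2) \<rightarrow> Inn_Aut_central Y (i + 1) \<and>
     Aut_central Y i \<lhd> AutoGroup Y\<lparr>carrier := Aut_central Y (i + 1)\<rparr> \<and>
     Inn_Aut_central Y i \<lhd> AutoGroup Y\<lparr>carrier := Inn_Aut_central Y (i + 1)\<rparr> \<and>
     group_hom (AutoGroup T\<lparr>carrier := Aut_central T (i + 2)\<rparr>)
           (AutoGroup Y\<lparr>carrier := Aut_central Y (i + 1)\<rparr> Mod Aut_central Y i)
           (\<lambda>g. Aut_central Y i #>\<^bsub>AutoGroup Y\<^esub> \<Lambda> g) \<and>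
     kernel (AutoGroup T\<lparr>carrier := Aut_central T (i + 2)\<rparr>)
           (AutoGroup Y\<lparr>carrier := Aut_central Y (i + 1)\<rparr> Mod Aut_central Y i)
           (\<lambda>g. Aut_central Y i #>\<^bsub>AutoGroup Y\<^esub> \<Lambda> g)
         = Aut_central T (i + 1) \<and>
     group_hom (AutoGroup T\<lparr>carrier := Inn_Aut_central T (i + 2)\<rparr>)
           (AutoGroup Y\<lparr>carrier := Inn_Aut_central Y (i + 1)\<rparr> Mod Inn_Aut_central Y i)
           (\<lambda>g. Inn_Aut_central Y i #>\<^bsub>AutoGroup Y\<^esub> \<Lambda> g) \<and>
     kernel (AutoGroup T\<lparr>carrier := Inn_Aut_central T (i + 2)\<rparr>)
           (AutoGroup Y\<lparr>carrier := Inn_Aut_central Y (i + 1)\<rparr> Mod Inn_Aut_central Y i)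
           (\<lambda>g. Inn_Aut_central Y i #>\<^bsub>AutoGroup Y\<^esub> \<Lambda> g)
         = Inn_Aut_central T (i + 1) \<and>
     (\<exists>S. subgroup S (AutoGroup Y\<lparr>carrier := Aut_central Y (i + 1)\<rparr> Mod Aut_central Y i) \<and>
           AutoGroup T\<lparr>carrier := Aut_central T (i + 2)\<rparr> Mod Aut_central T (i + 1)
           \<cong> (AutoGroup Y\<lparr>carrier := Aut_central Y (i + 1)\<rparr> Mod Aut_central Y i)\<lparr>carrier := S\<rparr>) \<and>
     (\<exists>f. f \<in> mon
           (AutoGroup T\<lparr>carrier := Inn_Aut_central T (i + 2)\<rparr> Mod Inn_Aut_central T (i + 1))
           (AutoGroup Y\<lparr>carrier := Inn_Aut_central Y (i + 1)\<rparr> Mod Inn_Aut_central Y i))"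
proof -
  interpret T: group T by (rule T)
  interpret Y: group Y
    unfolding Y by (rule normal.factorgroup_is_group[OF T.upper_central_normal])
  interpret \<Lambda>: group_hom "AutoGroup T" "AutoGroup Y" \<Lambda>
    unfolding Y \<Lambda> by (rule T.induced_auto_group_hom)
  note subs = normal_imp_subgroup[OF T.Aut_central_normal] normal_imp_subgroup[OF Y.Aut_central_normal]
    normal_imp_subgroup[OF T.Inn_Aut_central_normal] normal_imp_subgroup[OF Y.Inn_Aut_central_normal]
  have in_auto: "g \<in> auto T" if "g \<in> Aut_central T j \<or> g \<in> Inn_Aut_central T j" for g j
    using that subs(1,3)[THEN subgroup.subset] by auto
  have pre: "\<Lambda> g \<in> Aut_central Y j \<longleftrightarrow> g \<in> Aut_central T (Suc j)"
    and preI: "\<Lambda> g \<in> Inn_Aut_central Y j \<longleftrightarrow> g \<in> Inn_Aut_central T (Suc j)"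
    if "g \<in> auto T" for g j
    unfolding Y \<Lambda>
    using T.induced_auto_in_Aut_central_iff[OF that] T.induced_auto_in_Inn_Aut_central_iff[OF that] by auto
  have map: "\<Lambda> \<in> Aut_central T (i + 2) \<rightarrow> Aut_central Y (i + 1)"
    and mapI: "\<Lambda> \<in> Inn_Aut_central T (i + 2) \<rightarrow> Inn_Aut_central Y (i + 1)"
    using pre[of _ "i + 1"] preI[of _ "i + 1"] in_auto by auto
  have le: "Aut_central Y i \<subseteq> Aut_central Y (i + 1)"
    and leI: "Inn_Aut_central Y i \<subseteq> Inn_Aut_central Y (i + 1)"
    using Y.Aut_central_le_Suc Y.Inn_Aut_central_le_Suc by simp_all
  note q = \<Lambda>.hom_into_subquotient[OF subs(1,2) Y.Aut_central_normal le map]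
  note qI = \<Lambda>.hom_into_subquotient[OF subs(3,4) Y.Inn_Aut_central_normal leI mapI]
  have "{g \<in> Aut_central T (i + 2). \<Lambda> g \<in> Aut_central Y i} = Aut_central T (i + 1)"
    using pre[of _ i] in_auto T.Aut_central_le_Suc[of "i + 1"] by auto
  with q(3) have ker: "kernel (AutoGroup T\<lparr>carrier := Aut_central T (i + 2)\<rparr>)
      (AutoGroup Y\<lparr>carrier := Aut_central Y (i + 1)\<rparr> Mod Aut_central Y i)
      (\<lambda>g. Aut_central Y i #>\<^bsub>AutoGroup Y\<^esub> \<Lambda> g) = Aut_central T (i + 1)"
    by simp
  have "{g \<in> Inn_Aut_central T (i + 2). \<Lambda> g \<in> Inn_Aut_central Y i} = Inn_Aut_central T (i + 1)"
    using preI[of _ i] in_auto T.Inn_Aut_central_le_Suc[of "i + 1"] by auto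
  with qI(3) have kerI: "kernel (AutoGroup T\<lparr>carrier := Inn_Aut_central T (i + 2)\<rparr>)
      (AutoGroup Y\<lparr>carrier := Inn_Aut_central Y (i + 1)\<rparr> Mod Inn_Aut_central Y i)
      (\<lambda>g. Inn_Aut_central Y i #>\<^bsub>AutoGroup Y\<^esub> \<Lambda> g) = Inn_Aut_central T (i + 1)"
    by simp
  show ?thesis
    using map mapI q(1,2) qI(1,2) ker kerI
      group_hom.FactGroup_kernel_iso_subgroup[OF q(2), unfolded ker]
      group_hom.FactGroup_kernel_mon[OF qI(2), unfolded kerI]
    by (intro conjI)
qed

end
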